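(* Let $G$ be a finite simple graph, $\mathbb{F}$ a field and $r$ a positive integer. Then \[ \bar{\mathcal{H}}_f(M_r(G); \mathbb{F}) \leq \bar{\mathcal{H}}_f(G; \mathbb{F}) + \frac{1}{\sum_{k=0}^{r-1} (\bar{\mathcal{H}}_f(G; \mathbb{F}) - 1)^k}, \] with the convention $0^0=1$.
   Context: For a simple graph $G$ and positive integer $r$, the generalized Mycielskian $M_r(G)$ has vertex set $V(G)\times\{0,1,\dots,r-1\}\cup\{z\}$ and edge set consisting of: $\{(v,0),(w,0)\}$ for $\{v,w\}\in E(G)$; $\{(v,i),(w,j)\}$ for $\{v,w\}\in E(G)$ and $|i-j|=1$; and $\{(v,r-1),z\}$ for all $v\in V(G)$. For a field $\mathbb{F}$, a collection $\{X_v\subseteq\mathbb{F}^n : v\in V(G)\}$ is a dual $(n,d)$-representation of $G$ over $\mathbb{F}$ if for every vertex $v$: $X_v$ is a subspace of $\mathbb{F}^n$, $\dim X_v=d$, and $X_v\cap\left(\sum_{w\in N(v)}X_w\right)=\{0\}$, where $N(v)$ is the neighborhood of $v$ and the sum is the subspace sum. The complementary fractional Haemers bound is $\bar{\mathcal{H}}_f(G;\mathbb{F})=\inf\{n/d : G \text{ has a dual }(n,d)\text{-representation over }\mathbb{F}\}$. *)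

theory Defs
  imports Complex_Main "HOL-Library.Function_Algebras"
begin

record 'a ugraph =
  verts :: "'a set"
  edges :: "'a set set"

definition finite_simple_graph :: "'a ugraph \<Rightarrow> bool" where
  "finite_simple_graph G \<longleftrightarrow>
     finite (verts G) \<and> (\<forall>e\<in>edges G. e \<subseteq> verts G \<and> card e = 2)"

definition nbhd :: "'a ugraph \<Rightarrow> 'a \<Rightarrow> 'a set" where
  "nbhd G v = {w. {v, w} \<in> edges G}"

datatype 'a myc_vertex = Layer 'a nat | Apex

definition mycielskian :: "nat \<Rightarrow> 'a ugraph \<Rightarrow> 'a myc_vertex ugraph" where
  "mycielskian r G =
     \<lparr> verts = {Layer v i | v i. v \<in> verts G \<and> i < r} \<union> {Apex},
       edges = {{Layer v 0, Layer w 0} | v w. {v, w} \<in> edges G}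
             \<union> {{Layer v i, Layer w j} | v w i j.
                  {v, w} \<in> edges G \<and> i < r \<and> j < r \<and> \<bar>int i - int j\<bar> = 1}
             \<union> {{Layer v (r - 1), Apex} | v. v \<in> verts G} \<rparr>"

text \<open>
  Because \<open>n\<close> varies in the infimum below, \<open>F\<^sup>n\<close> is realised inside the vector space of all
  sequences over \<open>F\<close>, as the sequences vanishing from index \<open>n\<close> on.
\<close>

definition seq_scale :: "'f::field \<Rightarrow> (nat \<Rightarrow> 'f) \<Rightarrow> nat \<Rightarrow> 'f" where
  "seq_scale c x = (\<lambda>i. c * x i)"

interpretation seqs: vector_space "seq_scale :: 'f::field \<Rightarrow> (nat \<Rightarrow> 'f) \<Rightarrow> nat \<Rightarrow> 'f"
  by unfold_locales (auto simp: seq_scale_def fun_eq_iff algebra_simps)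

definition coord_space :: "nat \<Rightarrow> (nat \<Rightarrow> 'f::field) set" where
  "coord_space n = {x. \<forall>i\<ge>n. x i = 0}"

definition subspace_sum :: "('a \<Rightarrow> 'v::comm_monoid_add set) \<Rightarrow> 'a set \<Rightarrow> 'v set" where
  "subspace_sum X W = {(\<Sum>w\<in>W. x w) | x. \<forall>w\<in>W. x w \<in> X w}"

definition dual_rep ::
  "'a ugraph \<Rightarrow> nat \<Rightarrow> nat \<Rightarrow> ('a \<Rightarrow> (nat \<Rightarrow> 'f::field) set) \<Rightarrow> bool" where
  "dual_rep G n d X \<longleftrightarrow>
     (\<forall>v\<in>verts G.
        X v \<subseteq> coord_space n \<and> seqs.subspace (X v) \<and> seqs.dim (X v) = d \<and>
        X v \<inter> subspace_sum X (nbhd G v) = {0})"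

text \<open>
  The positivity of \<open>d\<close> is implicit in the quotient \<open>n/d\<close>: every graph has a dual
  \<open>(n,0)\<close>-representation.  The field is passed as a type argument.
\<close>

definition comp_frac_haemers :: "'f::field itself \<Rightarrow> 'a ugraph \<Rightarrow> real" where
  "comp_frac_haemers F G =
     Inf {real n / real d | n d.
       d > 0 \<and> (\<exists>X :: 'a \<Rightarrow> (nat \<Rightarrow> 'f) set. dual_rep G n d X)}"

end

theory Submission
  imports Defs
begin

text \<open>
  Give the vertex \<open>(v, i)\<close> level \<open>i\<close> and the apex level \<open>r\<close>. For every \<open>k \<le> r\<close>, a dual
  \<open>(n, d)\<close>-representation \<open>X\<close> of \<open>G\<close> yields a representation of the Mycielskian in \<open>F\<^sup>n\<close> whose
  dimensions depend on the level: use \<open>X\<^sub>v\<close> on the levels below \<open>k\<close>, and from level \<open>k\<close> on alternate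
  between \<open>0\<close> and all of \<open>F\<^sup>n\<close>. Direct sums of such representations add up both the ambient
  dimension and the dimensions at each vertex. Put \<open>m = n - d\<close>. Taking \<open>m\<^bsup>k-1\<^esup> d\<^bsup>r-k\<^esup>\<close> copies for each
  \<open>k \<ge> 1\<close>, and \<open>d\<^sup>r\<close> copies of the \<open>k = 0\<close> pattern in \<open>F\<^sup>1\<close> (which does not involve \<open>X\<close>), makes all
  dimensions equal to \<open>d T\<close> in a space of dimension \<open>n T + d\<^sup>r\<close>, where
  \<open>T = \<Sum>\<^bsub>j<r\<^esub> m\<^sup>j d\<^bsup>r-1-j\<^esup>\<close>. With \<open>x = n/d\<close> the quotient is \<open>x + 1 / \<Sum>\<^bsub>k<r\<^esub> (x - 1)\<^sup>k\<close>, a continuous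
  function of \<open>x \<ge> 1\<close>, so one may pass to the infimum.
\<close>

section \<open>Coordinate spaces\<close>

lemma sum_fun_apply: "(\<Sum>a\<in>A. f a) i = (\<Sum>a\<in>A. f a i)"
  for f :: "'b \<Rightarrow> 'c \<Rightarrow> 'd::comm_monoid_add"
  by (induction A rule: infinite_finite_induct) auto

lemma subspace_coord_space: "seqs.subspace (coord_space n)"
  by (auto simp: seqs.subspace_def coord_space_def seq_scale_def)

definition unit_seq :: "nat \<Rightarrow> nat \<Rightarrow> 'f::field" where
  "unit_seq i = (\<lambda>j. if j = i then 1 else 0)"

lemma inj_unit_seq: "inj (unit_seq :: nat \<Rightarrow> nat \<Rightarrow> 'f::field)"
  by (rule injI) (metis unit_seq_def zero_neq_one)

lemma sum_scale_unit_seq: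
  assumes "finite A"
  shows "(\<Sum>i\<in>A. seq_scale (c i) (unit_seq i)) j = (if j \<in> A then c j else 0)"
proof -
  have "(\<Sum>i\<in>A. seq_scale (c i) (unit_seq i)) j = (\<Sum>i\<in>A. if j = i then c i else 0)"
    unfolding sum_fun_apply by (rule sum.cong) (auto simp: seq_scale_def unit_seq_def)
  with assms show ?thesis by simp
qed

lemma coord_space_subset_span: "coord_space n \<subseteq> seqs.span (unit_seq ` {..<n})"
proof
  fix x :: "nat \<Rightarrow> 'f::field" assume x: "x \<in> coord_space n"
  have "x = (\<Sum>i<n. seq_scale (x i) (unit_seq i))"
  proof
    fix j
    show "x j = (\<Sum>i<n. seq_scale (x i) (unit_seq i)) j"
      unfolding sum_scale_unit_seq[OF finite_lessThan] using x by (auto simp: coord_space_def)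
  qed
  moreover have "(\<Sum>i<n. seq_scale (x i) (unit_seq i)) \<in> seqs.span (unit_seq ` {..<n})"
    by (intro seqs.span_sum seqs.span_scale seqs.span_base) auto
  ultimately show "x \<in> seqs.span (unit_seq ` {..<n})" by simp
qed

lemma card_unit_seqs: "card ((unit_seq :: nat \<Rightarrow> nat \<Rightarrow> 'f::field) ` {..<n}) = n"
  by (simp add: card_image inj_on_subset[OF inj_unit_seq])

lemma dim_coord_space: "seqs.dim (coord_space n :: (nat \<Rightarrow> 'f::field) set) = n"
proof (rule seqs.dim_unique[OF _ coord_space_subset_span _ card_unit_seqs])
  show "unit_seq ` {..<n} \<subseteq> (coord_space n :: (nat \<Rightarrow> 'f) set)"
    by (auto simp: coord_space_def unit_seq_def)
  show "seqs.independent ((unit_seq :: nat \<Rightarrow> nat \<Rightarrow> 'f) ` {..<n})"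
  proof
    assume "seqs.dependent ((unit_seq :: nat \<Rightarrow> nat \<Rightarrow> 'f) ` {..<n})"
    then obtain u and j where j: "j < n" "u (unit_seq j :: nat \<Rightarrow> 'f) \<noteq> 0"
      and 0: "(\<Sum>v\<in>unit_seq ` {..<n}. seq_scale (u v) v) = (0 :: nat \<Rightarrow> 'f)"
      by (auto simp: seqs.dependent_finite)
    have "(\<Sum>i<n. seq_scale (u (unit_seq i)) (unit_seq i)) = (0 :: nat \<Rightarrow> 'f)"
      using 0 by (simp add: sum.reindex inj_on_subset[OF inj_unit_seq] o_def)
    then have "(\<Sum>i<n. seq_scale (u (unit_seq i)) (unit_seq i)) j = (0 :: 'f)"
      by simp
    then show False
      using j by (subst (asm) sum_scale_unit_seq) auto
  qed
qed

lemma dim_zero_space: "seqs.dim {0 :: nat \<Rightarrow> 'f::field} = 0"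
  by (rule seqs.dim_unique[of "{}"]) (auto simp: seqs.independent_empty)

text \<open>The space of all sequences is infinite-dimensional, so finiteness comes from the ambient
  \<open>coord_space n\<close>: an independent set in the span of \<open>n\<close> unit sequences is
  finite.\<close>

lemma finite_basis_exists:
  fixes S :: "(nat \<Rightarrow> 'f::field) set"
  assumes "S \<subseteq> coord_space n"
  obtains B where "finite B" "B \<subseteq> S" "seqs.independent B" "S \<subseteq> seqs.span B"
    "card B = seqs.dim S"
proof -
  obtain B where B: "B \<subseteq> S" "seqs.independent B" "S \<subseteq> seqs.span B" "card B = seqs.dim S"
    by (rule seqs.basis_exists)
  have "B \<subseteq> seqs.span (unit_seq ` {..<n})"
    using B(1) assms coord_space_subset_span by blast
  then have "finite B"
    using seqs.independent_span_bound[OF _ B(2)] by blast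
  with B that show ?thesis by blast
qed

lemma dim_le_if_subset_coord_space:
  fixes S :: "(nat \<Rightarrow> 'f::field) set"
  assumes "S \<subseteq> coord_space n"
  shows "seqs.dim S \<le> n"
proof -
  have "S \<subseteq> seqs.span (unit_seq ` {..<n})"
    using assms coord_space_subset_span by blast
  then have "seqs.dim S \<le> card ((unit_seq :: nat \<Rightarrow> nat \<Rightarrow> 'f) ` {..<n})"
    by (rule seqs.dim_le_card) simp
  then show ?thesis by (simp only: card_unit_seqs)
qed


section \<open>Direct sums\<close>

definition seq_take :: "nat \<Rightarrow> (nat \<Rightarrow> 'f::field) \<Rightarrow> nat \<Rightarrow> 'f" where
  "seq_take n x = (\<lambda>i. if i < n then x i else 0)"

definition seq_drop :: "nat \<Rightarrow> (nat \<Rightarrow> 'f::field) \<Rightarrow> nat \<Rightarrow> 'f" where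
  "seq_drop n x = (\<lambda>i. x (i + n))"

definition seq_shift :: "nat \<Rightarrow> (nat \<Rightarrow> 'f::field) \<Rightarrow> nat \<Rightarrow> 'f" where
  "seq_shift n x = (\<lambda>i. if i < n then 0 else x (i - n))"

interpretation seq_take: Vector_Spaces.linear seq_scale seq_scale "seq_take n" for n
  by unfold_locales (auto simp: seq_take_def seq_scale_def fun_eq_iff algebra_simps)

interpretation seq_drop: Vector_Spaces.linear seq_scale seq_scale "seq_drop n" for n
  by unfold_locales (auto simp: seq_drop_def seq_scale_def fun_eq_iff algebra_simps)

interpretation seq_shift: Vector_Spaces.linear seq_scale seq_scale "seq_shift n" for n
  by unfold_locales (auto simp: seq_shift_def seq_scale_def fun_eq_iff algebra_simps)

lemma seq_take_plus_shift_drop: "seq_take n x + seq_shift n (seq_drop n x) = x"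
  by (auto simp: seq_take_def seq_shift_def seq_drop_def fun_eq_iff)

lemma seq_take_shift [simp]: "seq_take n (seq_shift n x) = 0"
  by (auto simp: seq_take_def seq_shift_def fun_eq_iff)

lemma seq_drop_shift [simp]: "seq_drop n (seq_shift n x) = x"
  by (auto simp: seq_drop_def seq_shift_def fun_eq_iff)

lemma seq_take_id: "x \<in> coord_space n \<Longrightarrow> seq_take n x = x"
  by (auto simp: seq_take_def coord_space_def fun_eq_iff)

lemma seq_drop_0: "x \<in> coord_space n \<Longrightarrow> seq_drop n x = 0"
  by (auto simp: seq_drop_def coord_space_def fun_eq_iff)

text \<open>Phrased by the two block projections, so that membership splits into one condition per
  summand. The argument \<open>n\<close> is the ambient dimension of \<open>S\<close>, which
  \<open>S\<close> alone does not determine.\<close>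

definition direct_sum ::
  "nat \<Rightarrow> (nat \<Rightarrow> 'f::field) set \<Rightarrow> (nat \<Rightarrow> 'f) set \<Rightarrow> (nat \<Rightarrow> 'f) set" where
  "direct_sum n S T = {x. seq_take n x \<in> S \<and> seq_drop n x \<in> T}"

lemma subspace_direct_sum:
  "seqs.subspace S \<Longrightarrow> seqs.subspace T \<Longrightarrow> seqs.subspace (direct_sum n S T)"
  by (auto simp: seqs.subspace_def direct_sum_def seq_take.add seq_drop.add
      seq_take.scale seq_drop.scale)

lemma direct_sum_subset_coord_space:
  assumes "T \<subseteq> coord_space m"
  shows "direct_sum n S T \<subseteq> coord_space (n + m)"
proof
  fix x assume "x \<in> direct_sum n S T"
  then have *: "seq_drop n x \<in> coord_space m" using assms by (auto simp: direct_sum_def)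
  have "x i = 0" if "i \<ge> n + m" for i
    using * that by (auto simp: coord_space_def seq_drop_def dest: spec[of _ "i - n"])
  then show "x \<in> coord_space (n + m)" by (simp add: coord_space_def)
qed

text \<open>A basis of \<open>S\<close> and a shifted basis of \<open>T\<close> together form a
  basis: the block projections split a linear relation into its two parts.\<close>

lemma dim_direct_sum:
  fixes S T :: "(nat \<Rightarrow> 'f::field) set"
  assumes S: "S \<subseteq> coord_space n" "seqs.subspace S" and T: "T \<subseteq> coord_space m" "seqs.subspace T"
  shows "seqs.dim (direct_sum n S T) = seqs.dim S + seqs.dim T"
proof -
  obtain B where B: "finite B" "B \<subseteq> S" "seqs.independent B" "S \<subseteq> seqs.span B"
    "card B = seqs.dim S" using S(1) by (rule finite_basis_exists)
  obtain C where C: "finite C" "C \<subseteq> T" "seqs.independent C" "T \<subseteq> seqs.span C"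
    "card C = seqs.dim T" using T(1) by (rule finite_basis_exists)
  let ?C = "seq_shift n ` C"
  have inj: "inj_on (seq_shift n) A" for A :: "(nat \<Rightarrow> 'f) set"
    by (rule inj_on_inverseI) (rule seq_drop_shift)
  have take_B: "seq_take n b = b" and drop_B: "seq_drop n b = 0" if "b \<in> B" for b
    using that B(2) S(1) by (auto intro!: seq_take_id seq_drop_0)
  \<comment> \<open>A common vector would be both fixed and killed by \<open>seq_take n\<close>, but
    an independent set does not contain 0.\<close>
  have disj: "B \<inter> ?C = {}"
  proof (rule ccontr)
    assume "B \<inter> ?C \<noteq> {}"
    then obtain b c where "b \<in> B" "b = seq_shift n c" by blast
    then have "b = 0" using take_B[of b] by simp
    with \<open>b \<in> B\<close> B(3) seqs.dependent_zero show False by blast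
  qed
  show ?thesis
  proof (rule seqs.dim_unique[of "B \<union> ?C"])
    have "0 \<in> S" "0 \<in> T" using S(2) T(2) by (auto simp: seqs.subspace_0)
    then show "B \<union> ?C \<subseteq> direct_sum n S T"
      using take_B drop_B B(2) C(2) by (auto simp: direct_sum_def)
    show "direct_sum n S T \<subseteq> seqs.span (B \<union> ?C)"
    proof
      fix x assume x: "x \<in> direct_sum n S T"
      have "seq_take n x \<in> seqs.span (B \<union> ?C)"
        using x B(4) seqs.span_mono[of B "B \<union> ?C"] by (auto simp: direct_sum_def)
      moreover have "seq_shift n (seq_drop n x) \<in> seqs.span ?C"
        using x C(4) unfolding seq_shift.span_image by (auto simp: direct_sum_def)
      then have "seq_shift n (seq_drop n x) \<in> seqs.span (B \<union> ?C)"
        using seqs.span_mono[of ?C "B \<union> ?C"] by auto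
      ultimately show "x \<in> seqs.span (B \<union> ?C)"
        by (metis seqs.span_add seq_take_plus_shift_drop)
    qed
    show "card (B \<union> ?C) = seqs.dim S + seqs.dim T"
      using B C disj by (simp add: card_Un_disjoint card_image inj)
    show "seqs.independent (B \<union> ?C)"
    proof
      assume "seqs.dependent (B \<union> ?C)"
      then obtain u v where v: "v \<in> B \<union> ?C" "u v \<noteq> 0"
        and "(\<Sum>v\<in>B \<union> ?C. seq_scale (u v) v) = 0"
        using B(1) C(1) by (auto simp: seqs.dependent_finite)
      then have eq: "(\<Sum>b\<in>B. seq_scale (u b) b)
          + (\<Sum>c\<in>C. seq_scale (u (seq_shift n c)) (seq_shift n c)) = 0"
        using B(1) C(1) disj by (simp add: sum.union_disjoint sum.reindex inj)
      have "(\<Sum>b\<in>B. seq_scale (u b) b) = 0"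
        using arg_cong[OF eq, of "seq_take n"] take_B
        by (simp add: seq_take.add seq_take.sum seq_take.scale seq_take.zero)
      then have 1: "u b = 0" if "b \<in> B" for b
        using B(1,3) that by (auto simp: seqs.dependent_finite)
      have "(\<Sum>c\<in>C. seq_scale (u (seq_shift n c)) c) = 0"
        using arg_cong[OF eq, of "seq_drop n"] drop_B
        by (simp add: seq_drop.add seq_drop.sum seq_drop.scale seq_drop.zero)
      then have 2: "u (seq_shift n c) = 0" if "c \<in> C" for c
        using C(1,3) that unfolding seqs.dependent_finite[OF C(1)]
        by (auto dest: spec[of _ "\<lambda>c. u (seq_shift n c)"])
      from 1 2 v show False by auto
    qed
  qed
qed


section \<open>Representations with varying dimensions\<close>

lemma subspace_sum_least:
  assumes "seqs.subspace S" "\<And>w. w \<in> W \<Longrightarrow> X w \<subseteq> S"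
  shows "subspace_sum X W \<subseteq> S"
  using assms by (auto simp: subspace_sum_def intro!: seqs.subspace_sum)

lemma zero_in_subspace_sum:
  assumes "\<And>w. w \<in> W \<Longrightarrow> 0 \<in> X w"
  shows "0 \<in> subspace_sum X W"
  unfolding subspace_sum_def using assms by (auto intro!: exI[of _ "\<lambda>_. 0"])

lemma subspace_subspace_sum:
  assumes "\<And>w. w \<in> W \<Longrightarrow> seqs.subspace (X w)"
  shows "seqs.subspace (subspace_sum X W)"
  unfolding seqs.subspace_def
proof (intro conjI ballI allI)
  show "0 \<in> subspace_sum X W"
    using assms by (intro zero_in_subspace_sum) (auto simp: seqs.subspace_0)
next
  fix a b assume "a \<in> subspace_sum X W" "b \<in> subspace_sum X W"
  then obtain x y where "a = sum x W" "\<forall>w\<in>W. x w \<in> X w" "b = sum y W" "\<forall>w\<in>W. y w \<in> X w"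
    by (auto simp: subspace_sum_def)
  with assms show "a + b \<in> subspace_sum X W"
    by (auto simp: subspace_sum_def sum.distrib seqs.subspace_add
        intro!: exI[of _ "\<lambda>w. x w + y w"])
next
  fix c a assume "a \<in> subspace_sum X W"
  then obtain x where "a = sum x W" "\<forall>w\<in>W. x w \<in> X w"
    by (auto simp: subspace_sum_def)
  with assms show "seq_scale c a \<in> subspace_sum X W"
    by (auto simp: subspace_sum_def seqs.scale_sum_right seqs.subspace_scale
        intro!: exI[of _ "\<lambda>w. seq_scale c (x w)"])
qed

lemma subset_subspace_sum:
  assumes "finite W" "v \<in> W" "\<And>w. w \<in> W \<Longrightarrow> 0 \<in> X w"
  shows "X v \<subseteq> subspace_sum X W"
proof
  fix a assume "a \<in> X v"
  \<comment> \<open>Finiteness of \<open>W\<close> matters here, since sums over infinite sets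
    default to 0.\<close>
  moreover have "a = (\<Sum>w\<in>W. if v = w then a else 0)" using assms by simp
  ultimately show "a \<in> subspace_sum X W"
    unfolding subspace_sum_def using assms
    by (intro CollectI exI[of _ "\<lambda>w. if v = w then a else 0"]) auto
qed

text \<open>Unlike in \<open>dual_rep\<close>, the dimension may depend on the vertex: the building
  blocks for the Mycielskian are uniform only after they are added up.\<close>

definition has_rep :: "'f::field itself \<Rightarrow> 'a ugraph \<Rightarrow> nat \<Rightarrow> ('a \<Rightarrow> nat) \<Rightarrow> bool" where
  "has_rep F G n \<delta> \<longleftrightarrow> (\<exists>X :: 'a \<Rightarrow> (nat \<Rightarrow> 'f) set. \<forall>v\<in>verts G.
     X v \<subseteq> coord_space n \<and> seqs.subspace (X v) \<and> seqs.dim (X v) = \<delta> v \<and>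
     X v \<inter> subspace_sum X (nbhd G v) = {0})"

lemma has_rep_cong:
  "has_rep F G n \<delta> \<Longrightarrow> (\<And>v. v \<in> verts G \<Longrightarrow> \<delta> v = \<epsilon> v) \<Longrightarrow> has_rep F G n \<epsilon>"
  by (simp add: has_rep_def)

lemma has_rep_iff_dual_rep:
  "has_rep TYPE('f::field) G n (\<lambda>_. d) \<longleftrightarrow> (\<exists>X :: 'a \<Rightarrow> (nat \<Rightarrow> 'f) set. dual_rep G n d X)"
  by (simp add: has_rep_def dual_rep_def)

lemma nbhd_subset_verts: "finite_simple_graph G \<Longrightarrow> nbhd G v \<subseteq> verts G"
  by (auto simp: finite_simple_graph_def nbhd_def)

lemma finite_nbhd: "finite_simple_graph G \<Longrightarrow> finite (nbhd G v)"
  using nbhd_subset_verts[of G v] finite_subset unfolding finite_simple_graph_def by blast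

lemma not_in_own_nbhd: "finite_simple_graph G \<Longrightarrow> v \<notin> nbhd G v"
  by (fastforce simp: finite_simple_graph_def nbhd_def)

lemma has_rep_zero: "has_rep (F :: 'f::field itself) G n (\<lambda>_. 0)"
  unfolding has_rep_def
proof (intro exI[of _ "\<lambda>_. {0}"] ballI conjI)
  fix v
  show "{0} \<inter> subspace_sum (\<lambda>_. {0 :: nat \<Rightarrow> 'f}) (nbhd G v) = {0}"
    using zero_in_subspace_sum[of "nbhd G v" "\<lambda>_. {0 :: nat \<Rightarrow> 'f}"] by auto
qed (auto simp: coord_space_def dim_zero_space)

text \<open>Vertexwise direct sums work because the intersection condition can be checked in each
  block separately.\<close>

lemma has_rep_add:
  fixes F :: "'f::field itself"
  assumes G: "finite_simple_graph G" and "has_rep F G n \<delta>" "has_rep F G m \<epsilon>"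
  shows "has_rep F G (n + m) (\<lambda>v. \<delta> v + \<epsilon> v)"
proof -
  obtain X :: "_ \<Rightarrow> (nat \<Rightarrow> 'f) set" where X: "\<And>v. v \<in> verts G \<Longrightarrow> X v \<subseteq> coord_space n"
    "\<And>v. v \<in> verts G \<Longrightarrow> seqs.subspace (X v)" "\<And>v. v \<in> verts G \<Longrightarrow> seqs.dim (X v) = \<delta> v"
    "\<And>v. v \<in> verts G \<Longrightarrow> X v \<inter> subspace_sum X (nbhd G v) = {0}"
    using assms(2) unfolding has_rep_def by metis
  obtain Y :: "_ \<Rightarrow> (nat \<Rightarrow> 'f) set" where Y: "\<And>v. v \<in> verts G \<Longrightarrow> Y v \<subseteq> coord_space m"
    "\<And>v. v \<in> verts G \<Longrightarrow> seqs.subspace (Y v)" "\<And>v. v \<in> verts G \<Longrightarrow> seqs.dim (Y v) = \<epsilon> v"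
    "\<And>v. v \<in> verts G \<Longrightarrow> Y v \<inter> subspace_sum Y (nbhd G v) = {0}"
    using assms(3) unfolding has_rep_def by metis
  define Z where "Z v = direct_sum n (X v) (Y v)" for v
  show ?thesis
    unfolding has_rep_def
  proof (intro exI[of _ Z] ballI conjI)
    fix v assume v: "v \<in> verts G"
    show "Z v \<subseteq> coord_space (n + m)"
      unfolding Z_def using Y(1)[OF v] by (rule direct_sum_subset_coord_space)
    show Zv: "seqs.subspace (Z v)"
      unfolding Z_def using X(2)[OF v] Y(2)[OF v] by (rule subspace_direct_sum)
    show "seqs.dim (Z v) = \<delta> v + \<epsilon> v"
      unfolding Z_def using dim_direct_sum[OF X(1)[OF v] X(2)[OF v] Y(1)[OF v] Y(2)[OF v]] X(3) Y(3) v by simp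
    have nb: "w \<in> verts G" if "w \<in> nbhd G v" for w
      using that nbhd_subset_verts[OF G] by blast
    show "Z v \<inter> subspace_sum Z (nbhd G v) = {0}"
    proof (intro equalityI subsetI)
      fix x assume x: "x \<in> Z v \<inter> subspace_sum Z (nbhd G v)"
      \<comment> \<open>By this inclusion each block of \<open>x\<close> lies in an intersection
        that is trivial by the condition on \<open>X\<close> or on \<open>Y\<close>.\<close>
      have "subspace_sum Z (nbhd G v)
          \<subseteq> direct_sum n (subspace_sum X (nbhd G v)) (subspace_sum Y (nbhd G v))"
      proof (rule subspace_sum_least)
        show "seqs.subspace (direct_sum n (subspace_sum X (nbhd G v)) (subspace_sum Y (nbhd G v)))"
          using X(2) Y(2) nb by (intro subspace_direct_sum subspace_subspace_sum) auto
        fix w assume w: "w \<in> nbhd G v"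
        have "X w \<subseteq> subspace_sum X (nbhd G v)"
          using X(2) nb w finite_nbhd[OF G] by (intro subset_subspace_sum) (auto intro: seqs.subspace_0)
        moreover have "Y w \<subseteq> subspace_sum Y (nbhd G v)"
          using Y(2) nb w finite_nbhd[OF G] by (intro subset_subspace_sum) (auto intro: seqs.subspace_0)
        ultimately show "Z w \<subseteq> direct_sum n (subspace_sum X (nbhd G v)) (subspace_sum Y (nbhd G v))"
          unfolding Z_def direct_sum_def by blast
      qed
      with x have "seq_take n x \<in> X v \<inter> subspace_sum X (nbhd G v)"
        "seq_drop n x \<in> Y v \<inter> subspace_sum Y (nbhd G v)"
        unfolding Z_def direct_sum_def by blast+
      then have "seq_take n x = 0" "seq_drop n x = 0" using X(4) Y(4) v by auto
      then have "x = 0" using seq_take_plus_shift_drop[of n x] by (simp add: seq_shift.zero)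
      then show "x \<in> {0}" by simp
    next
      fix x :: "nat \<Rightarrow> 'f" assume "x \<in> {0}"
      moreover have "0 \<in> Z w" if "w \<in> verts G" for w
        unfolding Z_def using that X(2) Y(2) by (intro seqs.subspace_0 subspace_direct_sum)
      ultimately show "x \<in> Z v \<inter> subspace_sum Z (nbhd G v)"
        using v nb zero_in_subspace_sum[of "nbhd G v" Z] by auto
    qed
  qed
qed

lemma has_rep_mult:
  assumes "finite_simple_graph G" "has_rep (F :: 'f::field itself) G n \<delta>"
  shows "has_rep F G (c * n) (\<lambda>v. c * \<delta> v)"
proof (induction c)
  case 0
  show ?case by (simp add: has_rep_zero)
next
  case (Suc c)
  show ?case using has_rep_add[OF assms(1) assms(2) Suc] by simp
qed

lemma has_rep_sum:
  assumes "finite_simple_graph G" "finite K"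
    "\<And>k. k \<in> K \<Longrightarrow> has_rep (F :: 'f::field itself) G (n k) (\<delta> k)"
  shows "has_rep F G (\<Sum>k\<in>K. n k) (\<lambda>v. \<Sum>k\<in>K. \<delta> k v)"
  using assms(2,3)
proof (induction K rule: finite_induct)
  case empty
  show ?case by (simp add: has_rep_zero)
next
  case (insert k K)
  then show ?case using has_rep_add[OF assms(1), of F "n k" "\<delta> k"] by simp
qed

text \<open>A line at \<open>u\<close> and zero elsewhere: without loops, the neighbours of
  \<open>u\<close> all carry 0.\<close>

lemma has_rep_single_vertex:
  assumes G: "finite_simple_graph G"
  shows "has_rep TYPE('f::field) G 1 (\<lambda>v. if v = u then 1 else 0)"
proof -
  define X :: "'a \<Rightarrow> (nat \<Rightarrow> 'f) set" where "X v = (if v = u then coord_space 1 else {0})" for v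
  have "subspace_sum X (nbhd G u) \<subseteq> {0}"
    using not_in_own_nbhd[OF G] by (intro subspace_sum_least) (auto simp: X_def)
  moreover have zero: "0 \<in> X v" for v by (auto simp: X_def coord_space_def)
  moreover have "0 \<in> subspace_sum X (nbhd G v)" for v
    using zero by (rule zero_in_subspace_sum)
  ultimately have "X v \<inter> subspace_sum X (nbhd G v) = {0}" for v
    by (cases "v = u") (auto simp: X_def coord_space_def)
  moreover have "X v \<subseteq> coord_space 1" "seqs.subspace (X v)"
    "seqs.dim (X v) = (if v = u then 1 else 0)" for v
    by (auto simp: X_def subspace_coord_space dim_coord_space dim_zero_space)
      (simp add: coord_space_def)
  ultimately show ?thesis
    unfolding has_rep_def by blast
qed

text \<open>Adds up the one-vertex representations. It ensures that the infimum defining the Haemers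
  bound is taken over a nonempty set.\<close>

lemma has_rep_card_verts:
  assumes G: "finite_simple_graph G"
  shows "has_rep TYPE('f::field) G (card (verts G)) (\<lambda>_. 1)"
proof -
  have fin: "finite (verts G)" using G by (simp add: finite_simple_graph_def)
  have "has_rep TYPE('f) G (\<Sum>u\<in>verts G. 1) (\<lambda>v. \<Sum>u\<in>verts G. if v = u then 1 else 0)"
    using has_rep_sum[OF G fin has_rep_single_vertex[OF G]] by simp
  then show ?thesis using fin by (auto elim: has_rep_cong)
qed


section \<open>The generalized Mycielskian\<close>

fun level :: "nat \<Rightarrow> 'a myc_vertex \<Rightarrow> nat" where
  "level r (Layer v i) = i"
| "level r Apex = r"

lemma finite_simple_mycielskian:
  assumes G: "finite_simple_graph G" and r: "r > 0"
  shows "finite_simple_graph (mycielskian r G)"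
proof -
  have "{Layer v i | v i. v \<in> verts G \<and> i < r} = (\<lambda>(v, i). Layer v i) ` (verts G \<times> {..<r})"
    by auto
  then have "finite {Layer v i | v i. v \<in> verts G \<and> i < r}"
    using G by (simp add: finite_simple_graph_def)
  moreover have "v \<in> verts G \<and> w \<in> verts G \<and> v \<noteq> w" if "{v, w} \<in> edges G" for v w
    using G that by (fastforce simp: finite_simple_graph_def)
  ultimately show ?thesis
    using r by (auto simp: finite_simple_graph_def mycielskian_def card_insert_if)
qed

text \<open>With the apex placed right after layer \<open>r - 1\<close>, only the edges inside the
  bottom layer fail to change the level by one.\<close>

lemma nbhd_mycielskian_level:
  assumes "x \<in> verts (mycielskian r G)" "y \<in> nbhd (mycielskian r G) x" "r > 0"
  shows "level r y = Suc (level r x) \<or> level r x = Suc (level r y) \<or> level r x = 0 \<and> level r y = 0"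
  using assms by (auto simp: nbhd_def mycielskian_def doubleton_eq_iff)

text \<open>Forgetting the layer index sends every edge that avoids the apex to an edge of
  \<open>G\<close>; this transfers the condition on \<open>X\<close> to the lower levels.\<close>

lemma nbhd_mycielskian_base:
  assumes "Layer w j \<in> nbhd (mycielskian r G) (Layer v i)"
  shows "w \<in> nbhd G v"
  using assms by (auto simp: nbhd_def mycielskian_def doubleton_eq_iff insert_commute)

text \<open>The alternation starts with 0 at level \<open>k\<close>. This zero layer shields the
  copies of \<open>X\<close> below it from the full spaces above; for \<open>k = 0\<close> it is the
  bottom layer, whose vertices may be adjacent to each other.\<close>

definition layer_dim :: "nat \<Rightarrow> nat \<Rightarrow> nat \<Rightarrow> nat \<Rightarrow> nat" where
  "layer_dim n d k i = (if i < k then d else if odd (i - k) then n else 0)"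

text \<open>Below level \<open>k\<close>, a neighbour contributes either some \<open>X w\<close>
  with \<open>w\<close> adjacent in \<open>G\<close>, or 0 if it is at level \<open>k\<close>. A
  vertex with the full space has only neighbours with 0, and a vertex with 0 meets any sum
  trivially.\<close>

lemma has_rep_mycielskian:
  fixes F :: "'f::field itself"
  assumes G: "finite_simple_graph G" and r: "r > 0" and k: "k \<le> r"
    and rep: "has_rep F G n (\<lambda>_. d)"
  shows "has_rep F (mycielskian r G) n (\<lambda>x. layer_dim n d k (level r x))"
proof -
  let ?M = "mycielskian r G"
  obtain X :: "_ \<Rightarrow> (nat \<Rightarrow> 'f) set" where X: "\<And>v. v \<in> verts G \<Longrightarrow> X v \<subseteq> coord_space n"
    "\<And>v. v \<in> verts G \<Longrightarrow> seqs.subspace (X v)" "\<And>v. v \<in> verts G \<Longrightarrow> seqs.dim (X v) = d"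
    "\<And>v. v \<in> verts G \<Longrightarrow> X v \<inter> subspace_sum X (nbhd G v) = {0}"
    using rep unfolding has_rep_def by metis
  \<comment> \<open>The value at \<open>Apex\<close> is arbitrary: its level \<open>r\<close> is at
    least \<open>k\<close>, so \<open>Y\<close> never reads it.\<close>
  define base where "base x = (case x of Layer v i \<Rightarrow> v | Apex \<Rightarrow> undefined)" for x :: "'a myc_vertex"
  define Y where "Y x = (if level r x < k then X (base x)
    else if odd (level r x - k) then coord_space n else {0})" for x
  have base_verts: "base x \<in> verts G" if "x \<in> verts ?M" "level r x < k" for x
    using that k by (auto simp: mycielskian_def base_def)
  have sub: "seqs.subspace (Y x)" if "x \<in> verts ?M" for x
    using that base_verts X(2) by (simp add: Y_def subspace_coord_space)
  note M = finite_simple_mycielskian[OF G r]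
  show ?thesis
    unfolding has_rep_def
  proof (intro exI[of _ Y] ballI conjI)
    fix x assume x: "x \<in> verts ?M"
    show "Y x \<subseteq> coord_space n"
      using base_verts[OF x] X(1) by (auto simp: Y_def coord_space_def)
    show "seqs.subspace (Y x)" using sub[OF x] .
    show "seqs.dim (Y x) = layer_dim n d k (level r x)"
      using base_verts[OF x] X(3) by (simp add: Y_def layer_dim_def dim_coord_space dim_zero_space)
    have nb: "y \<in> verts ?M" if "y \<in> nbhd ?M x" for y
      using that nbhd_subset_verts[OF M] by blast
    have "0 \<in> Y x" "0 \<in> subspace_sum Y (nbhd ?M x)"
      using seqs.subspace_0[OF sub] x nb by (auto intro!: zero_in_subspace_sum)
    moreover have "Y x \<inter> subspace_sum Y (nbhd ?M x) \<subseteq> {0}"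
    proof (cases "level r x < k")
      case True
      then obtain v i where xv: "x = Layer v i" using k by (cases x) auto
      have v: "v \<in> verts G" using base_verts[OF x True] by (simp add: xv base_def)
      have nbv: "w \<in> verts G" if "w \<in> nbhd G v" for w
        using that nbhd_subset_verts[OF G] by blast
      have "subspace_sum Y (nbhd ?M x) \<subseteq> subspace_sum X (nbhd G v)"
      proof (rule subspace_sum_least)
        show sX: "seqs.subspace (subspace_sum X (nbhd G v))"
          using X(2) nbv by (intro subspace_subspace_sum) auto
        fix y assume y: "y \<in> nbhd ?M x"
        show "Y y \<subseteq> subspace_sum X (nbhd G v)"
        proof (cases "level r y < k")
          case yk: True
          then obtain w j where yw: "y = Layer w j" using k by (cases y) auto
          have "w \<in> nbhd G v" using y nbhd_mycielskian_base by (simp add: xv yw)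
          then have "X w \<subseteq> subspace_sum X (nbhd G v)"
            using X(2) nbv finite_nbhd[OF G]
            by (intro subset_subspace_sum) (auto intro: seqs.subspace_0)
          then show ?thesis using yk by (simp add: Y_def yw base_def)
        next
          case False
          \<comment> \<open>Adjacent levels differ by at most one, so an edge leaving the region
            below \<open>k\<close> ends in the zero layer.\<close>
          then have "level r y = k" using nbhd_mycielskian_level[OF x y r] True by linarith
          then show ?thesis using sX by (simp add: Y_def seqs.subspace_0)
        qed
      qed
      moreover have "Y x = X v" using True by (simp add: Y_def xv base_def)
      ultimately show ?thesis using X(4)[OF v] by auto
    next
      case False
      show ?thesis
      proof (cases "odd (level r x - k)")
        case True
        have "subspace_sum Y (nbhd ?M x) \<subseteq> {0}"
        proof (rule subspace_sum_least)
          fix y assume y: "y \<in> nbhd ?M x"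
          \<comment> \<open>Up to level \<open>k\<close> the truncated difference is 0, hence even.
            So \<open>x\<close> is not in the bottom layer, and its neighbours are exactly one level
            away, at level at least \<open>k\<close> and of the other parity.\<close>
          have "k < level r x" using True by (cases "level r x \<le> k") auto
          then have "k \<le> level r y \<and> even (level r y - k)"
            using nbhd_mycielskian_level[OF x y r] True
            by (auto simp: Suc_diff_le)
          then show "Y y \<subseteq> {0}" by (auto simp: Y_def)
        qed simp
        then show ?thesis by auto
      next
        case even: False
        then show ?thesis using False by (auto simp: Y_def)
      qed
    qed
    ultimately show "Y x \<inter> subspace_sum Y (nbhd ?M x) = {0}" by blast
  qed
qed

section \<open>Weights that make all dimensions equal\<close>

text \<open>Counts the pattern \<open>k = 0\<close> and the patterns
  \<open>k = j + 1 \<le> i\<close>. From \<open>i\<close> to \<open>i + 2\<close> the old parities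
  persist; of the new terms on the left only \<open>j = i\<close> is nonzero, and
  \<open>m ^ i * d ^ (r - Suc i) * (m + d)\<close> is the sum of the two new terms on the
  right.\<close>

lemma weighted_full_layers:
  assumes "i \<le> r"
  shows "d ^ r * (if odd i then 1 else 0)
      + (\<Sum>j<i. m ^ j * d ^ (r - Suc j) * (if odd (i - Suc j) then m + d else 0))
    = (\<Sum>j<i. m ^ j * d ^ (r - j) :: nat)"
  using assms
proof (induction i rule: induct_nat_012)
  case (ge2 i)
  have *: "d ^ (r - i) = d * d ^ (r - Suc i)"
    using ge2.prems by (metis Suc_diff_Suc Suc_le_lessD Suc_leD power_Suc)
  have "(\<Sum>j<i. m ^ j * d ^ (r - Suc j) * (if odd (Suc (Suc i) - Suc j) then m + d else 0))
      = (\<Sum>j<i. m ^ j * d ^ (r - Suc j) * (if odd (i - Suc j) then m + d else 0))"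
    by (intro sum.cong refl) (auto simp: Suc_diff_Suc Suc_diff_le)
  then show ?case
    using ge2.IH(1) ge2.prems * by (simp add: algebra_simps)
qed auto

text \<open>The patterns with \<open>k = j + 1 > i\<close> contribute \<open>d\<close> each, which
  turns their weight into \<open>m ^ j * d ^ (r - j)\<close>; the others give the same terms by
  \<open>weighted_full_layers\<close>.\<close>

lemma weighted_layer_dims:
  assumes "i \<le> r"
  shows "d ^ r * layer_dim 1 0 0 i
      + (\<Sum>j<r. m ^ j * d ^ (r - Suc j) * layer_dim (m + d) d (Suc j) i)
    = (\<Sum>j<r. m ^ j * d ^ (r - j) :: nat)"
proof -
  have split: "(\<Sum>j<r. f j) = (\<Sum>j<i. f j) + (\<Sum>j\<in>{i..<r}. f j)" for f :: "nat \<Rightarrow> nat"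
    using assms by (metis atLeast0LessThan sum.atLeastLessThan_concat zero_le)
  have "(\<Sum>j\<in>{i..<r}. m ^ j * d ^ (r - Suc j) * layer_dim (m + d) d (Suc j) i)
      = (\<Sum>j\<in>{i..<r}. m ^ j * d ^ (r - j))"
  proof (rule sum.cong)
    fix j assume "j \<in> {i..<r}"
    then have "d ^ (r - j) = d * d ^ (r - Suc j)" "i < Suc j"
      by (auto simp flip: power_Suc simp: Suc_diff_Suc)
    then show "m ^ j * d ^ (r - Suc j) * layer_dim (m + d) d (Suc j) i = m ^ j * d ^ (r - j)"
      by (simp add: layer_dim_def)
  qed simp
  moreover have "(\<Sum>j<i. m ^ j * d ^ (r - Suc j) * layer_dim (m + d) d (Suc j) i)
      = (\<Sum>j<i. m ^ j * d ^ (r - Suc j) * (if odd (i - Suc j) then m + d else 0))"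
    by (intro sum.cong) (auto simp: layer_dim_def)
  moreover have "layer_dim 1 0 0 i = (if odd i then 1 else 0)"
    by (simp add: layer_dim_def)
  ultimately show ?thesis
    using weighted_full_layers[OF assms, of d m] unfolding split by simp
qed

lemma has_rep_mycielskian_uniform:
  assumes G: "finite_simple_graph G" and r: "r > 0"
    and rep: "has_rep TYPE('f::field) G (m + d) (\<lambda>_. d)"
  shows "has_rep TYPE('f) (mycielskian r G)
    (d ^ r + (\<Sum>j<r. m ^ j * d ^ (r - Suc j) * (m + d))) (\<lambda>_. \<Sum>j<r. m ^ j * d ^ (r - j))"
proof -
  let ?M = "mycielskian r G"
  note M = finite_simple_mycielskian[OF G r]
  \<comment> \<open>The pattern \<open>k = 0\<close> does not see \<open>X\<close>, so it is built
    on the zero representation of \<open>G\<close> in a one-dimensional space and costs only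
    \<open>d ^ r\<close> ambient dimensions.\<close>
  have "has_rep TYPE('f) ?M (d ^ r * 1) (\<lambda>x. d ^ r * layer_dim 1 0 0 (level r x))"
    by (intro has_rep_mult[OF M] has_rep_mycielskian[OF G r] has_rep_zero) simp
  moreover have "has_rep TYPE('f) ?M (\<Sum>j<r. m ^ j * d ^ (r - Suc j) * (m + d))
      (\<lambda>x. \<Sum>j<r. m ^ j * d ^ (r - Suc j) * layer_dim (m + d) d (Suc j) (level r x))"
    by (intro has_rep_sum[OF M] has_rep_mult[OF M] has_rep_mycielskian[OF G r _ rep]) auto
  ultimately have "has_rep TYPE('f) ?M (d ^ r * 1 + (\<Sum>j<r. m ^ j * d ^ (r - Suc j) * (m + d)))
      (\<lambda>x. d ^ r * layer_dim 1 0 0 (level r x)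
        + (\<Sum>j<r. m ^ j * d ^ (r - Suc j) * layer_dim (m + d) d (Suc j) (level r x)))"
    by (rule has_rep_add[OF M])
  then have "has_rep TYPE('f) ?M (d ^ r * 1 + (\<Sum>j<r. m ^ j * d ^ (r - Suc j) * (m + d)))
      (\<lambda>_. \<Sum>j<r. m ^ j * d ^ (r - j))"
  proof (rule has_rep_cong)
    fix x assume "x \<in> verts ?M"
    then have "level r x \<le> r" by (auto simp: mycielskian_def)
    then show "d ^ r * layer_dim 1 0 0 (level r x)
        + (\<Sum>j<r. m ^ j * d ^ (r - Suc j) * layer_dim (m + d) d (Suc j) (level r x))
      = (\<Sum>j<r. m ^ j * d ^ (r - j))"
      by (rule weighted_layer_dims)
  qed
  then show ?thesis by simp
qed

section \<open>From representations to the infimum\<close>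

lemma comp_frac_haemers_le:
  assumes "has_rep TYPE('f::field) G n (\<lambda>_. d)" "d > 0"
  shows "comp_frac_haemers TYPE('f) G \<le> real n / real d"
  unfolding comp_frac_haemers_def has_rep_iff_dual_rep[symmetric]
  by (rule cInf_lower) (use assms in \<open>auto intro!: bdd_belowI[of _ 0]\<close>)

text \<open>The quotient \<open>(d ^ r + n * T) / (d * T)\<close> is \<open>n / d\<close> plus
  \<open>d ^ r / (d * T)\<close>, and the latter is \<open>1 / S\<close> once the denominators in
  the geometric sum \<open>S\<close> are cleared by \<open>d ^ r\<close>.\<close>

lemma comp_frac_haemers_mycielskian_le:
  assumes G: "finite_simple_graph G" and r: "r > 0"
    and rep: "has_rep TYPE('f::field) G n (\<lambda>_. d)" and d: "d > 0" and nd: "d \<le> n"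
  shows "comp_frac_haemers TYPE('f) (mycielskian r G)
    \<le> real n / real d + 1 / (\<Sum>k=0..r-1. (real n / real d - 1) ^ k)"
proof -
  obtain m where n: "n = m + d" using nd by (metis add.commute le_Suc_ex)
  define T where "T = (\<Sum>j<r. m ^ j * d ^ (r - Suc j))"
  define S where "S = (\<Sum>k=0..r-1. (real n / real d - 1) ^ k)"
  have D: "(\<Sum>j<r. m ^ j * d ^ (r - j)) = d * T"
    unfolding T_def sum_distrib_left
    by (intro sum.cong refl) (simp add: Suc_diff_Suc flip: power_Suc)
  have N: "(\<Sum>j<r. m ^ j * d ^ (r - Suc j) * (m + d)) = n * T"
    by (simp add: T_def n sum_distrib_left mult.commute)
  have x: "real n / real d - 1 = real m / real d"
    using d by (simp add: n field_simps)
  have "S * real d ^ r = (\<Sum>j<r. real m ^ j * real d ^ (r - j))"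
  proof -
    have "{0..r-1} = {..<r}" using r by auto
    then have "S * real d ^ r = (\<Sum>j<r. (real m / real d) ^ j * real d ^ r)"
      by (simp add: S_def x sum_distrib_right)
    also have "\<dots> = (\<Sum>j<r. real m ^ j * real d ^ (r - j))"
      using d by (intro sum.cong refl) (simp add: power_divide power_diff)
    finally show ?thesis .
  qed
  also have "\<dots> = real (d * T)" unfolding D[symmetric] by simp
  finally have S: "S * real d ^ r = real d * real T" by simp
  \<comment> \<open>The summand for \<open>j = 0\<close> is \<open>d ^ (r - 1)\<close>.\<close>
  have "T > 0"
    unfolding T_def using r d by (intro sum_pos2[of _ 0]) auto
  then have "S \<noteq> 0" using S d by auto
  have "has_rep TYPE('f) (mycielskian r G) (d ^ r + n * T) (\<lambda>_. d * T)"
    using has_rep_mycielskian_uniform[OF G r rep[unfolded n]] unfolding D N .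
  then have "comp_frac_haemers TYPE('f) (mycielskian r G) \<le> real (d ^ r + n * T) / real (d * T)"
    using d \<open>T > 0\<close> by (intro comp_frac_haemers_le) auto
  also have "\<dots> = real n / real d + real d ^ r / (real d * real T)"
    using d \<open>T > 0\<close> by (simp add: field_simps)
  also have "\<dots> = real n / real d + 1 / S"
    unfolding S[symmetric] using d by simp
  finally show ?thesis by (simp add: S_def)
qed

text \<open>Keeps every quotient at least 1, where the geometric sum is positive and
  \<open>n\<close> can be written as \<open>m + d\<close>.\<close>

lemma has_rep_dim_le:
  assumes "has_rep TYPE('f::field) G n (\<lambda>_. d)" "verts G \<noteq> {}"
  shows "d \<le> n"
proof -
  obtain v where "v \<in> verts G" using assms(2) by blast
  then obtain S :: "(nat \<Rightarrow> 'f) set" where "S \<subseteq> coord_space n" "seqs.dim S = d"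
    using assms(1) unfolding has_rep_def by blast
  then show ?thesis using dim_le_if_subset_coord_space by blast
qed

theorem theorem1:
  fixes G :: "'a ugraph" and r :: nat
  assumes "finite_simple_graph G" and "verts G \<noteq> {}" and "r > 0"
  shows "comp_frac_haemers TYPE('f::field) (mycielskian r G)
           \<le> comp_frac_haemers TYPE('f) G
             + 1 / (\<Sum>k=0..r-1. (comp_frac_haemers TYPE('f) G - 1) ^ k)"
proof -
  define R where "R = {real n / real d | n d. d > 0 \<and> has_rep TYPE('f) G n (\<lambda>_. d)}"
  have H: "comp_frac_haemers TYPE('f) G = Inf R"
    by (simp add: comp_frac_haemers_def R_def has_rep_iff_dual_rep)
  define g :: "real \<Rightarrow> real" where "g x = x + 1 / (\<Sum>k=0..r-1. (x - 1) ^ k)" for x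
  have ge1: "1 \<le> x" if "x \<in> R" for x
    using that has_rep_dim_le[OF _ assms(2)] by (auto simp: R_def)
  have bound: "comp_frac_haemers TYPE('f) (mycielskian r G) \<le> g x" if "x \<in> R" for x
    using that has_rep_dim_le[OF _ assms(2)]
      comp_frac_haemers_mycielskian_le[OF assms(1,3)] by (auto simp: R_def g_def)
  have "real (card (verts G)) / real 1 \<in> R"
    unfolding R_def using has_rep_card_verts[OF assms(1)] by blast
  then have ne: "R \<noteq> {}" by blast
  have bdd: "bdd_below R" using ge1 by (rule bdd_belowI)
  have inf1: "1 \<le> Inf R" using ne ge1 by (rule cInf_greatest)
  \<comment> \<open>The infimum need not be attained, so the bound \<open>g\<close> is carried along
    a sequence in \<open>R\<close> that tends to it.\<close>
  have "\<exists>x\<in>R. x < Inf R + 1 / real (Suc j)" for j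
    using cInf_lessD[OF ne, of "Inf R + 1 / real (Suc j)"] by force
  then obtain s where s: "\<And>j. s j \<in> R" "\<And>j. s j < Inf R + 1 / real (Suc j)" by metis
  have "s \<longlonglongrightarrow> Inf R"
  proof (rule real_tendsto_sandwich[of "\<lambda>_. Inf R" _ _ "\<lambda>j. Inf R + 1 / real (Suc j)"])
    show "(\<lambda>j. Inf R + 1 / real (Suc j)) \<longlonglongrightarrow> Inf R"
      using tendsto_add[OF tendsto_const LIMSEQ_inverse_real_of_nat, of "Inf R"]
      by (simp add: inverse_eq_divide)
  qed (use s(1) cInf_lower[OF _ bdd] less_imp_le[OF s(2)] in \<open>auto simp del: of_nat_Suc\<close>)
  moreover have "isCont g (Inf R)"
  proof -
    \<comment> \<open>The summand \<open>k = 0\<close> is 1, even for \<open>Inf R = 1\<close> by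
      \<open>0 ^ 0 = 1\<close>, and the others are nonnegative; so the denominator in
      \<open>g\<close> does not vanish.\<close>
    have "(\<Sum>k\<in>{0}. (Inf R - 1) ^ k) \<le> (\<Sum>k=0..r-1. (Inf R - 1) ^ k)"
      using inf1 by (intro sum_mono2) auto
    then have "(\<Sum>k=0..r-1. (Inf R - 1) ^ k) \<noteq> 0" by simp
    then show ?thesis unfolding g_def by (intro continuous_intros)
  qed
  ultimately have "(\<lambda>j. g (s j)) \<longlonglongrightarrow> g (Inf R)"
    by (rule isCont_tendsto_compose[rotated])
  then have "comp_frac_haemers TYPE('f) (mycielskian r G) \<le> g (Inf R)"
    using bound s(1) by (intro LIMSEQ_le_const) auto
  then show ?thesis by (simp add: H g_def)
qed

end
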